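(* Let $p\ge 1$ be an integer. Each mapping $F\in\mathcal{HS}_p$ is starlike with respect to the origin.
   Context: $\mathbb{D}=\{z\in\mathbb{C}:|z|<1\}$. For an integer $p\ge1$, $\mathcal{H}_p$ is the set of polyharmonic mappings $F$ in $\mathbb{D}$ of the form $$F(z)=\sum_{k=1}^{p}|z|^{2(k-1)}\big(h_k(z)+\overline{g_k(z)}\big)=\sum_{k=1}^{p}|z|^{2(k-1)}\sum_{j=1}^{\infty}\big(a_{k,j}z^j+\overline{b_{k,j}}\,\overline{z^j}\big),$$ with $h_k(z)=\sum_{j\ge1}a_{k,j}z^j$, $g_k(z)=\sum_{j\ge1}b_{k,j}z^j$ analytic in $\mathbb{D}$, $a_{1,1}=1$, $|b_{1,1}|<1$. $\mathcal{HS}_p$ is the class of $F\in\mathcal{H}_p$ satisfying $$\sum_{k=1}^{p}\sum_{j=2}^{\infty}\big(2(k-1)+j\big)\big(|a_{k,j}|+|b_{k,j}|\big)\le 1-|b_{1,1}|-\sum_{k=2}^{p}(2k-1)\big(|a_{k,1}|+|b_{k,1}|\big)$$ and $$0\le |b_{1,1}|+\sum_{k=2}^{p}(2k-1)\big(|a_{k,1}|+|b_{k,1}|\big)<1.$$ A univalent (i.e. injective) polyharmonic mapping $F$ of $\mathbb{D}$ with $F(0)=0$ is called starlike with respect to the origin if for each $r\in(0,1)$ the closed curve $\theta\mapsto F(re^{i\theta})$ is starlike with respect to the origin (i.e. the domain it bounds is starlike with respect to $0$). *)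

theory Defs
  imports "HOL-Complex_Analysis.Complex_Analysis"
begin

abbreviation unit_disc :: "complex set"
  where "unit_disc \<equiv> ball 0 1"

text \<open>
  \<open>a k j\<close> and \<open>b k j\<close> are the coefficients of \<open>z ^ j\<close> in \<open>h k\<close> and \<open>g k\<close>; only the values at
  \<open>1 \<le> k \<le> p\<close>, \<open>j \<ge> 1\<close> matter. Functions of this form are polyharmonic (annihilated by the
  \<open>p\<close>-th power of the Laplacian), so that is not a separate condition. Only the values of
  \<open>F\<close> on the disc are constrained.
\<close>

definition polyharmonic_expansion ::
    "nat \<Rightarrow> (nat \<Rightarrow> nat \<Rightarrow> complex) \<Rightarrow> (nat \<Rightarrow> nat \<Rightarrow> complex) \<Rightarrow> (complex \<Rightarrow> complex) \<Rightarrow> bool"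
  where "polyharmonic_expansion p a b F \<longleftrightarrow>
    (\<exists>h g :: nat \<Rightarrow> complex \<Rightarrow> complex.
       (\<forall>k\<in>{1..p}. h k holomorphic_on unit_disc \<and> g k holomorphic_on unit_disc) \<and>
       (\<forall>k\<in>{1..p}. \<forall>z\<in>unit_disc.
          ((\<lambda>j. a k j * z ^ j) has_sum h k z) {1..} \<and>
          ((\<lambda>j. b k j * z ^ j) has_sum g k z) {1..}) \<and>
       (\<forall>z\<in>unit_disc. F z =
          (\<Sum>k=1..p. of_real (cmod z ^ (2 * (k - 1))) * (h k z + cnj (g k z))))) \<and>
    a 1 1 = 1 \<and> cmod (b 1 1) < 1"

definition H_class :: "nat \<Rightarrow> (complex \<Rightarrow> complex) set"
  where "H_class p = {F. \<exists>a b. polyharmonic_expansion p a b F}"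

text \<open>
  The coefficients in the expansion of a member of \<open>H_class p\<close> are uniquely determined (for
  \<open>1 \<le> k \<le> p\<close>, \<open>j \<ge> 1\<close>), so the existential quantifier below involves no choice. Summability is
  stated explicitly because \<open>infsum\<close> has the value \<open>0\<close> on divergent families.
\<close>

definition HS_class :: "nat \<Rightarrow> (complex \<Rightarrow> complex) set"
  where "HS_class p = {F \<in> H_class p. \<exists>a b. polyharmonic_expansion p a b F \<and>
    (\<forall>k\<in>{1..p}. (\<lambda>j. real (2 * (k - 1) + j) * (cmod (a k j) + cmod (b k j))) summable_on {2..}) \<and>
    (\<Sum>k=1..p. \<Sum>\<^sub>\<infinity>j\<in>{2..}. real (2 * (k - 1) + j) * (cmod (a k j) + cmod (b k j)))
      \<le> 1 - cmod (b 1 1) - (\<Sum>k=2..p. real (2 * k - 1) * (cmod (a k 1) + cmod (b k 1))) \<and>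
    0 \<le> cmod (b 1 1) + (\<Sum>k=2..p. real (2 * k - 1) * (cmod (a k 1) + cmod (b k 1))) \<and>
    cmod (b 1 1) + (\<Sum>k=2..p. real (2 * k - 1) * (cmod (a k 1) + cmod (b k 1))) < 1}"

text \<open>The library predicate \<open>starlike\<close> leaves the centre existentially quantified.\<close>

definition starlike_wrt :: "complex \<Rightarrow> complex set \<Rightarrow> bool"
  where "starlike_wrt c S \<longleftrightarrow> c \<in> S \<and> (\<forall>x\<in>S. closed_segment c x \<subseteq> S)"

text \<open>
  The domain bounded by a Jordan curve is the \<open>inside\<close> of its path image. Requiring a simple
  closed path makes this domain meaningful; for the image of a circle under a continuous
  injective map the requirement holds automatically.
\<close>

definition starlike_curve :: "(real \<Rightarrow> complex) \<Rightarrow> bool"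
  where "starlike_curve \<gamma> \<longleftrightarrow>
    simple_path \<gamma> \<and> pathfinish \<gamma> = pathstart \<gamma> \<and> starlike_wrt 0 (inside (path_image \<gamma>))"

definition starlike_mapping :: "(complex \<Rightarrow> complex) \<Rightarrow> bool"
  where "starlike_mapping F \<longleftrightarrow>
    inj_on F unit_disc \<and> F 0 = 0 \<and> (\<forall>r\<in>{0<..<1}. starlike_curve (F \<circ> circlepath 0 r))"

end

theory Submission
  imports Defs
begin

text \<open>
  Write \<open>F = id + R\<close>. Each term \<open>u z = \<bar>z\<bar>\<^sup>m z\<^sup>j\<close> of the expansion satisfies
  \<open>\<bar>u z - u w\<bar> \<le> (m + j) \<bar>z - w\<bar>\<close>, and if \<open>\<bar>z\<bar> = \<bar>w\<bar>\<close> even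
  \<open>\<bar>u z - c u w\<bar> \<le> (m + j) \<bar>z - c w\<bar>\<close> for all \<open>c \<ge> 0\<close>. By the coefficient condition
  \<open>\<bar>R z - c R w\<bar> < \<bar>z - c w\<bar>\<close> unless \<open>z = c w\<close>. With \<open>c = 1\<close> this gives univalence;
  with \<open>c > 0\<close> and \<open>\<bar>z\<bar> = \<bar>w\<bar> = r\<close> it shows that every ray from the origin meets
  the image of the circle of radius \<open>r\<close> at most once, so the domain inside is starlike.
\<close>

section \<open>Lipschitz estimates for the monomials\<close>

text \<open>Telescoping, one factor at a time. The general type lets the bound serve powers of z as
  well as powers of its modulus.\<close>

lemma norm_power_diff_le:
  fixes z w :: "'a::{real_normed_algebra_1, comm_monoid_mult}"
  assumes "norm z \<le> r" "norm w \<le> r"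
  shows "norm (z ^ m - w ^ m) \<le> real m * r ^ (m - 1) * norm (z - w)"
proof (induction m)
  case (Suc m)
  have r: "0 \<le> r" using assms(1) norm_ge_zero order_trans by blast
  have "z ^ Suc m - w ^ Suc m = (z ^ m - w ^ m) * z + w ^ m * (z - w)"
    by (simp add: algebra_simps)
  then have "norm (z ^ Suc m - w ^ Suc m)
      \<le> norm (z ^ m - w ^ m) * norm z + norm (w ^ m) * norm (z - w)"
    by (simp only:) (intro norm_triangle_le add_mono norm_mult_ineq)
  also have "\<dots> \<le> real m * r ^ (m - 1) * norm (z - w) * r + r ^ m * norm (z - w)"
    using Suc assms r
    by (intro add_mono mult_mono order_trans[OF norm_power_ineq] power_mono) auto
  also have "\<dots> = real (Suc m) * r ^ (Suc m - 1) * norm (z - w)"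
    by (cases m) (auto simp: algebra_simps)
  finally show ?case .
qed auto

text \<open>The real factor is unchanged by conjugation, so the antianalytic terms of the expansion
  are conjugates of these and need no estimate of their own.\<close>

definition monomial_term :: "nat \<Rightarrow> nat \<Rightarrow> complex \<Rightarrow> complex"
  where "monomial_term m j z = of_real (cmod z ^ m) * z ^ j"

text \<open>Product rule for differences: the modulus factor contributes m and the power contributes
  j to the constant, each with a remaining factor r^(m+j-1).\<close>

lemma monomial_term_diff_le:
  assumes z: "cmod z \<le> r" and w: "cmod w \<le> r"
  shows "cmod (monomial_term m j z - monomial_term m j w)
           \<le> real (m + j) * r ^ (m + j - 1) * cmod (z - w)"
proof -
  have r: "0 \<le> r" using z norm_ge_zero order_trans by blast
  have A: "\<bar>cmod z ^ m - cmod w ^ m\<bar> \<le> real m * r ^ (m - 1) * cmod (z - w)"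
  proof -
    have "\<bar>cmod z ^ m - cmod w ^ m\<bar> \<le> real m * r ^ (m - 1) * \<bar>cmod z - cmod w\<bar>"
      using norm_power_diff_le[of "cmod z" r "cmod w" m] z w by simp
    also have "\<dots> \<le> real m * r ^ (m - 1) * cmod (z - w)"
      using r by (intro mult_left_mono norm_triangle_ineq3) auto
    finally show ?thesis .
  qed
  have B: "cmod (z ^ j - w ^ j) \<le> real j * r ^ (j - 1) * cmod (z - w)"
    using norm_power_diff_le z w by blast
  have "monomial_term m j z - monomial_term m j w
      = of_real (cmod z ^ m - cmod w ^ m) * z ^ j + of_real (cmod w ^ m) * (z ^ j - w ^ j)"
    by (simp add: monomial_term_def algebra_simps)
  then have "cmod (monomial_term m j z - monomial_term m j w)
      \<le> \<bar>cmod z ^ m - cmod w ^ m\<bar> * cmod z ^ j + cmod w ^ m * cmod (z ^ j - w ^ j)"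
    using norm_triangle_ineq[of "of_real (cmod z ^ m - cmod w ^ m) * z ^ j"
        "of_real (cmod w ^ m) * (z ^ j - w ^ j)"]
    by (simp only: norm_mult norm_of_real norm_power abs_norm_cancel power_abs)
  also have "\<dots> \<le> (real m * r ^ (m - 1) * cmod (z - w)) * r ^ j
      + r ^ m * (real j * r ^ (j - 1) * cmod (z - w))"
    by (intro add_mono mult_mono A B power_mono z w) (simp_all add: r)
  also have "\<dots> = (real m * r ^ (m - 1) * r ^ j + r ^ m * (real j * r ^ (j - 1))) * cmod (z - w)"
    by (simp add: algebra_simps)
  also have "real m * r ^ (m - 1) * r ^ j = real m * r ^ (m + j - 1)"
    by (cases m) (simp_all add: power_add)
  also have "r ^ m * (real j * r ^ (j - 1)) = real j * r ^ (m + j - 1)"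
    by (cases j) (simp_all add: power_add)
  also have "real m * r ^ (m + j - 1) + real j * r ^ (m + j - 1) = real (m + j) * r ^ (m + j - 1)"
    by (simp only: of_nat_add distrib_right)
  finally show ?thesis .
qed

text \<open>Both sides equal 1 - 2c Re x + c^2. The right side depends on x only through |x - 1|,
  which reduces a general c to the case c = 1.\<close>

lemma cmod_unit_minus_real_sq:
  assumes "cmod x = 1"
  shows "(cmod (x - of_real c))\<^sup>2 = (1 - c)\<^sup>2 + c * (cmod (x - 1))\<^sup>2"
proof -
  have "(Re x)\<^sup>2 + (Im x)\<^sup>2 = 1"
    using assms by (simp flip: cmod_power2)
  then have I: "(Im x)\<^sup>2 = 1 - (Re x)\<^sup>2" by simp
  show ?thesis
    by (simp add: cmod_power2 I) (simp add: power2_eq_square algebra_simps)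
qed

text \<open>Apply the preceding identity to x^j and to x. The terms in |x - 1| compare by the case c
  = 1, weighted by c \<ge> 0; the terms (1 - c)^2 compare because j \<ge> 1.\<close>

lemma cmod_unit_power_minus_real_le:
  assumes x: "cmod x = 1" and c: "0 \<le> c" and j: "1 \<le> j"
  shows "cmod (x ^ j - of_real c) \<le> real j * cmod (x - of_real c)"
proof -
  have "cmod (x ^ j - 1) \<le> real j * cmod (x - 1)"
    using norm_power_diff[of x 1 j] x by simp
  then have P: "(cmod (x ^ j - 1))\<^sup>2 \<le> (real j)\<^sup>2 * (cmod (x - 1))\<^sup>2"
    by (metis norm_ge_zero power_mono power_mult_distrib)
  have J: "1 * (1 - c)\<^sup>2 \<le> (real j)\<^sup>2 * (1 - c)\<^sup>2"
    using j by (intro mult_right_mono) auto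
  have "(cmod (x ^ j - of_real c))\<^sup>2 = (1 - c)\<^sup>2 + c * (cmod (x ^ j - 1))\<^sup>2"
    using x by (intro cmod_unit_minus_real_sq) (simp add: norm_power)
  also have "\<dots> \<le> (real j)\<^sup>2 * (1 - c)\<^sup>2 + c * ((real j)\<^sup>2 * (cmod (x - 1))\<^sup>2)"
    using J mult_left_mono[OF P c] by simp
  also have "\<dots> = (real j * cmod (x - of_real c))\<^sup>2"
    by (simp add: power_mult_distrib cmod_unit_minus_real_sq[OF x] algebra_simps)
  finally show ?thesis by (rule power2_le_imp_le) simp
qed

text \<open>On a common circle the modulus factor is the constant r^m, and dividing by w leaves the
  unimodular quotient x = z/w. The resulting factor j is enlarged to m + j to match the bound for c
  = 1.\<close>

lemma monomial_term_diff_scaled_le: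
  assumes z: "cmod z = r" and w: "cmod w = r" and r: "0 < r" and c: "0 \<le> c" and j: "1 \<le> j"
  shows "cmod (monomial_term m j z - of_real c * monomial_term m j w)
           \<le> real (m + j) * r ^ (m + j - 1) * cmod (z - of_real c * w)"
proof -
  have w0: "w \<noteq> 0" using w r by auto
  define x where "x = z / w"
  have x: "cmod x = 1" using z w r by (simp add: x_def norm_divide)
  have zx: "z = w * x" using w0 by (simp add: x_def)
  have "monomial_term m j z - of_real c * monomial_term m j w
      = of_real (r ^ m) * w ^ j * (x ^ j - of_real c)"
    unfolding monomial_term_def z w by (simp add: zx power_mult_distrib algebra_simps)
  then have "cmod (monomial_term m j z - of_real c * monomial_term m j w)
      = r ^ (m + j) * cmod (x ^ j - of_real c)"
    using r w by (simp add: norm_mult norm_power power_add)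
  also have "\<dots> \<le> r ^ (m + j) * (real j * cmod (x - of_real c))"
    using r by (intro mult_left_mono cmod_unit_power_minus_real_le x c j) auto
  also have "\<dots> = real j * r ^ (m + j - 1) * (r * cmod (x - of_real c))"
    using j by (cases j) auto
  also have "r * cmod (x - of_real c) = cmod (z - of_real c * w)"
  proof -
    have "z - of_real c * w = w * (x - of_real c)" by (simp add: zx algebra_simps)
    then show ?thesis by (simp add: norm_mult w)
  qed
  also have "real j * r ^ (m + j - 1) * cmod (z - of_real c * w)
      \<le> real (m + j) * r ^ (m + j - 1) * cmod (z - of_real c * w)"
    using r by (intro mult_right_mono) auto
  finally show ?thesis .
qed

section \<open>Deviation of F from the identity\<close>

text \<open>Common form of the two estimates above (c = 1 in a disc, c \<ge> 0 on a circle), so that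
  the coefficient condition has to be exploited only once.\<close>

definition monomial_bound :: "real \<Rightarrow> real \<Rightarrow> complex \<Rightarrow> complex \<Rightarrow> bool"
  where "monomial_bound r c z w \<longleftrightarrow> (\<forall>m j. 1 \<le> j \<longrightarrow>
    cmod (monomial_term m j z - of_real c * monomial_term m j w)
      \<le> real (m + j) * r ^ (m + j - 1) * cmod (z - of_real c * w))"

text \<open>Take q = |b_{1,1}|. The antianalytic linear term contributes q. Every other term of the
  deviation has degree n \<ge> 2 and gains r^(n-1) \<le> r, and by the coefficient condition the
  weights of these terms sum to at most 1 - q.\<close>

lemma HS_class_perturbation:
  assumes "p \<ge> 1" and "F \<in> HS_class p"
  obtains q where "0 \<le> q" "q < 1"
    "\<And>z w c r. \<lbrakk>cmod z < 1; cmod w < 1; 0 \<le> r; r < 1; monomial_bound r c z w\<rbrakk> \<Longrightarrow>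
       cmod (F z - of_real c * F w - (z - of_real c * w))
         \<le> (q + r * (1 - q)) * cmod (z - of_real c * w)"
proof -
  obtain a b where ex: "polyharmonic_expansion p a b F"
    and smm: "\<forall>k\<in>{1..p}. (\<lambda>j. real (2 * (k - 1) + j) * (cmod (a k j) + cmod (b k j))) summable_on {2..}"
    and le: "(\<Sum>k=1..p. \<Sum>\<^sub>\<infinity>j\<in>{2..}. real (2 * (k - 1) + j) * (cmod (a k j) + cmod (b k j)))
      \<le> 1 - cmod (b 1 1) - (\<Sum>k=2..p. real (2 * k - 1) * (cmod (a k 1) + cmod (b k 1)))"
    using assms(2) unfolding HS_class_def by blast
  obtain h g where
    hg: "\<And>k z. k \<in> {1..p} \<Longrightarrow> cmod z < 1 \<Longrightarrow>
          ((\<lambda>j. a k j * z ^ j) has_sum h k z) {1..} \<and> ((\<lambda>j. b k j * z ^ j) has_sum g k z) {1..}"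
    and F: "\<And>z. cmod z < 1 \<Longrightarrow> F z =
          (\<Sum>k=1..p. of_real (cmod z ^ (2 * (k - 1))) * (h k z + cnj (g k z)))"
    and a1: "a 1 1 = 1" and b1: "cmod (b 1 1) < 1"
    using ex unfolding polyharmonic_expansion_def Ball_def mem_ball_0 by blast
  define S where "S k = (\<Sum>\<^sub>\<infinity>j\<in>{2..}. real (2 * (k - 1) + j) * (cmod (a k j) + cmod (b k j)))" for k
  show ?thesis
  proof (rule that[of "cmod (b 1 1)"])
    fix z w c r
    assume z: "cmod z < 1" and w: "cmod w < 1" and r: "0 \<le> r" "r < 1"
      and mb: "monomial_bound r c z w"
    define d where "d = cmod (z - of_real c * w)"
    define D where "D k j = monomial_term (2 * (k - 1)) j z
        - of_real c * monomial_term (2 * (k - 1)) j w" for k j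
    \<comment> \<open>Since c is real it passes through conjugation: \<open>T k j\<close> is the
      share of the coefficients with indices k, j in F z - c F w, and \<open>E k\<close> is the
      share of the whole k-th summand.\<close>
    define T where "T k j = a k j * D k j + cnj (b k j * D k j)" for k j
    define E where "E k = of_real (cmod z ^ (2 * (k - 1))) * (h k z + cnj (g k z))
        - of_real c * (of_real (cmod w ^ (2 * (k - 1))) * (h k w + cnj (g k w)))" for k
    have d: "0 \<le> d" by (simp add: d_def)
    have D11: "D 1 1 = z - of_real c * w" by (simp add: D_def monomial_term_def)
    have normT: "cmod (T k j) \<le> (cmod (a k j) + cmod (b k j)) * cmod (D k j)" for k j
      unfolding T_def by (rule order_trans[OF norm_triangle_ineq]) (simp add: norm_mult algebra_simps)
    have bound: "cmod (T k j) \<le> r * d * (real (2 * (k - 1) + j) * (cmod (a k j) + cmod (b k j)))"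
      if "2 \<le> 2 * (k - 1) + j" "1 \<le> j" for k j
    proof -
      let ?n = "2 * (k - 1) + j"
      have "cmod (D k j) \<le> real ?n * r ^ (?n - 1) * d"
        using mb that(2) unfolding monomial_bound_def D_def d_def by blast
      also have "r ^ (?n - 1) \<le> r"
        using power_decreasing[of 1 "?n - 1" r] that(1) r by auto
      finally have Dle: "cmod (D k j) \<le> real ?n * r * d"
        using d by (simp add: mult_left_mono mult_right_mono)
      show ?thesis
        by (rule order_trans[OF normT], rule order_trans[OF mult_left_mono[OF Dle]])
          (auto simp: algebra_simps)
    qed
    \<comment> \<open>The terms with j = 1 are split off: for k = 1 the degree is 1 and
      \<open>bound\<close> does not apply, and for k \<ge> 2 their weights stand in a separate sum
      of the coefficient condition.\<close>
    have tail: "cmod (E k - T k 1) \<le> r * d * S k" if k: "k \<in> {1..p}" for k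
    proof -
      let ?f = "\<lambda>x j. a k j * monomial_term (2 * (k - 1)) j x
          + cnj (b k j * monomial_term (2 * (k - 1)) j x)"
      have "(?f x has_sum of_real (cmod x ^ (2 * (k - 1))) * (h k x + cnj (g k x))) {1..}"
        if "cmod x < 1" for x
      proof -
        have "((\<lambda>j. cnj (b k j * x ^ j)) has_sum cnj (g k x)) {1..}"
          using hg[OF k that] by (simp only: has_sum_cnj_iff)
        then have "((\<lambda>j. of_real (cmod x ^ (2 * (k - 1))) * (a k j * x ^ j + cnj (b k j * x ^ j)))
            has_sum of_real (cmod x ^ (2 * (k - 1))) * (h k x + cnj (g k x))) {1..}"
          using hg[OF k that] by (intro has_sum_cmult_right has_sum_add) auto
        then show ?thesis by (simp add: monomial_term_def algebra_simps)
      qed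
      from has_sum_add[OF this[OF z] has_sum_cmult_right[OF this[OF w], of "- of_real c"]]
      have "(T k has_sum E k) {1..}"
        by (simp add: T_def[abs_def] D_def E_def algebra_simps)
      moreover have "(T k has_sum T k 1) {1::nat}"
        using has_sum_finite[of "{1::nat}" "T k"] by simp
      ultimately have "(T k has_sum (E k - T k 1)) ({1..} - {1})"
        by (intro has_sum_Diff) auto
      also have "{1..} - {1::nat} = {2..}" by auto
      finally have hs: "(T k has_sum (E k - T k 1)) {2..}" .
      have "((\<lambda>j. r * d * (real (2 * (k - 1) + j) * (cmod (a k j) + cmod (b k j))))
          has_sum (r * d * S k)) {2..}"
        unfolding S_def using smm k by (intro has_sum_cmult_right has_sum_infsum) auto
      from norm_infsum_le[OF hs this] show ?thesis using bound by auto
    qed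
    have collect: "x * y + u + x * v = x * (y + v) + u" for x y u v :: real
      by (simp add: distrib_left)
    have regroup: "r * d * (1 - x) + x * d = (x + r * (1 - x)) * d" for x :: real
      by (simp add: algebra_simps)
    have split: "{1..p} = insert 1 {2..p}" using assms(1) by auto
    have "F z - of_real c * F w = (\<Sum>k=1..p. E k)"
      by (simp add: F z w E_def sum_subtractf sum_distrib_left)
    also have "\<dots> = (\<Sum>k=1..p. E k - T k 1) + (\<Sum>k=1..p. T k 1)"
      by (simp add: sum_subtractf)
    also have "(\<Sum>k=1..p. T k 1) = T 1 1 + (\<Sum>k=2..p. T k 1)"
      unfolding split by simp
    \<comment> \<open>Here a_{1,1} = 1 produces the identity part exactly.\<close>
    also have "T 1 1 = z - of_real c * w + cnj (b 1 1 * D 1 1)"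
      unfolding T_def a1 D11 by simp
    finally have eqn: "F z - of_real c * F w - (z - of_real c * w)
        = (\<Sum>k=1..p. E k - T k 1) + cnj (b 1 1 * D 1 1) + (\<Sum>k=2..p. T k 1)"
      by simp
    have "cmod (F z - of_real c * F w - (z - of_real c * w)) \<le> cmod (\<Sum>k=1..p. E k - T k 1) + cmod (cnj (b 1 1 * D 1 1))
        + cmod (\<Sum>k=2..p. T k 1)"
      unfolding eqn by (intro norm_triangle_mono order_refl)
    also have "\<dots> \<le> (\<Sum>k=1..p. r * d * S k) + cmod (b 1 1) * d
        + (\<Sum>k=2..p. r * d * (real (2 * k - 1) * (cmod (a k 1) + cmod (b k 1))))"
    proof (intro add_mono sum_norm_le)
      show "cmod (cnj (b 1 1 * D 1 1)) \<le> cmod (b 1 1) * d"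
        unfolding complex_mod_cnj norm_mult D11 d_def by simp
      show "cmod (T k 1) \<le> r * d * (real (2 * k - 1) * (cmod (a k 1) + cmod (b k 1)))"
        if "k \<in> {2..p}" for k
      proof -
        have "2 * (k - 1) + 1 = 2 * k - 1" using that by auto
        then show ?thesis using bound[of k 1] that by auto
      qed
    qed (use tail in auto)
    also have "\<dots> = r * d * ((\<Sum>k=1..p. S k)
        + (\<Sum>k=2..p. real (2 * k - 1) * (cmod (a k 1) + cmod (b k 1)))) + cmod (b 1 1) * d"
      unfolding sum_distrib_left[symmetric] by (rule collect)
    also have "\<dots> \<le> r * d * (1 - cmod (b 1 1)) + cmod (b 1 1) * d"
    proof (intro add_right_mono mult_left_mono)
      show "(\<Sum>k=1..p. S k) + (\<Sum>k=2..p. real (2 * k - 1) * (cmod (a k 1) + cmod (b k 1)))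
          \<le> 1 - cmod (b 1 1)"
        using le unfolding S_def by linarith
    qed (use r d in simp)
    also have "\<dots> = (cmod (b 1 1) + r * (1 - cmod (b 1 1))) * d"
      by (rule regroup)
    finally show "cmod (F z - of_real c * F w - (z - of_real c * w))
        \<le> (cmod (b 1 1) + r * (1 - cmod (b 1 1))) * cmod (z - of_real c * w)"
      by (simp only: d_def)
  qed (use b1 in auto)
qed

section \<open>A geometric criterion for starlike curves\<close>

text \<open>
  A point inside is shielded from infinity along its ray, so the unique crossing of that ray lies
  beyond the point and the segment to the origin stays off the curve.
\<close>

lemma starlike_curve_if_rays_cross_once:
  assumes simple: "simple_path \<gamma>" "pathfinish \<gamma> = pathstart \<gamma>"
    and zero: "0 \<notin> path_image \<gamma>"
    and once: "\<And>x c. \<lbrakk>x \<in> path_image \<gamma>; 0 < c; of_real c * x \<in> path_image \<gamma>\<rbrakk> \<Longrightarrow> c = 1"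
  shows "starlike_curve \<gamma>"
proof -
  let ?C = "path_image \<gamma>"
  have sub: "closed_segment 0 x \<subseteq> - ?C" if x: "x \<in> inside ?C" for x
  proof (cases "x = 0")
    case True
    then show ?thesis using zero by auto
  next
    case False
    have xC: "x \<notin> ?C" and bd: "bounded (connected_component_set (- ?C) x)"
      using x by (auto simp: inside_def)
    define R where "R = (\<lambda>t. of_real t * x) ` {1::real..}"
    have "\<not> R \<subseteq> - ?C"
    proof
      assume "R \<subseteq> - ?C"
      moreover have "connected R"
        unfolding R_def by (intro connected_continuous_image continuous_intros) auto
      moreover have "x \<in> R" unfolding R_def by (rule image_eqI[of _ _ 1]) auto
      ultimately have "R \<subseteq> connected_component_set (- ?C) x"
        by (intro connected_component_maximal)
      then have "bounded R" using bd bounded_subset by blast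
      then obtain B where B: "\<And>y. y \<in> R \<Longrightarrow> cmod y \<le> B" by (auto simp: bounded_iff)
      \<comment> \<open>Chosen so that t x has modulus |x| + |B|, which exceeds B.\<close>
      define t where "t = 1 + \<bar>B\<bar> / cmod x"
      have "of_real t * x \<in> R" unfolding R_def by (rule imageI) (simp add: t_def)
      from B[OF this] have "\<bar>t\<bar> * cmod x \<le> B" by (simp add: norm_mult)
      moreover have "\<bar>t\<bar> * cmod x = cmod x + \<bar>B\<bar>"
        using False by (simp add: t_def field_simps)
      moreover have "0 < cmod x" using False by simp
      ultimately show False by linarith
    qed
    then obtain t where t: "1 \<le> t" "of_real t * x \<in> ?C" by (auto simp: R_def)
    have t1: "1 < t" using t xC by (cases "t = 1") auto
    show ?thesis
    proof
      fix y assume "y \<in> closed_segment 0 x"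
      then obtain s where s: "0 \<le> s" "s \<le> 1" "y = of_real s * x"
        by (auto simp: in_segment scaleR_conv_of_real)
      show "y \<in> - ?C"
      proof
        assume yC: "y \<in> ?C"
        then have s0: "0 < s" using s zero by (cases "s = 0") auto
        \<comment> \<open>The curve would meet the ray at both s x and t x, so s = t, contrary to s
          \<le> 1 < t.\<close>
        have "of_real (t / s) * y = of_real t * x" using s s0 by simp
        then have "t / s = 1" using once[OF yC, of "t / s"] t s0 t1 by simp
        then show False using s0 s t1 by simp
      qed
    qed
  qed
  have seg: "closed_segment 0 x \<subseteq> inside ?C" if x: "x \<in> inside ?C" for x
  proof
    fix y assume "y \<in> closed_segment 0 x"
    then have "connected_component (- ?C) x y"
      using sub[OF x] unfolding connected_component_def
      by (meson connected_segment ends_in_segment(2))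
    then show "y \<in> inside ?C" using inside_same_component x by blast
  qed
  \<comment> \<open>The inside has some point by the Jordan curve theorem, and the segment from that
    point to the origin ends at 0.\<close>
  moreover have "inside ?C \<noteq> {}" using Jordan_inside_outside simple by blast
  ultimately have "0 \<in> inside ?C" by fastforce
  then show ?thesis using simple seg by (auto simp: starlike_curve_def starlike_wrt_def)
qed

section \<open>Univalence, continuity and starlikeness\<close>

theorem theorem3:
  fixes p :: nat and F :: "complex \<Rightarrow> complex"
  assumes "p \<ge> 1" and "F \<in> HS_class p"
  shows "starlike_mapping F"
proof -
  obtain q where q: "0 \<le> q" "q < 1"
    and pert: "\<And>z w c r. \<lbrakk>cmod z < 1; cmod w < 1; 0 \<le> r; r < 1; monomial_bound r c z w\<rbrakk> \<Longrightarrow>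
       cmod (F z - of_real c * F w - (z - of_real c * w))
         \<le> (q + r * (1 - q)) * cmod (z - of_real c * w)"
    using HS_class_perturbation[OF assms] by blast
  have lt1: "q + r * (1 - q) < 1" if "r < 1" for r :: real
  proof -
    have "0 < (1 - r) * (1 - q)" using that q by simp
    then show ?thesis by (simp add: algebra_simps)
  qed
  \<comment> \<open>If F z = c F w, the deviation is |z - c w| itself, yet it is at most a factor
    below 1 times |z - c w|. The case c = 1 yields injectivity, general c > 0 the crossing
    condition.\<close>
  have eq: "z = of_real c * w"
    if "cmod z < 1" "cmod w < 1" "0 \<le> r" "r < 1" "monomial_bound r c z w" "F z = of_real c * F w"
    for z w c r
  proof (rule ccontr)
    assume "z \<noteq> of_real c * w"
    then have "(q + r * (1 - q)) * cmod (z - of_real c * w) < 1 * cmod (z - of_real c * w)"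
      using lt1[OF that(4)] by (intro mult_strict_right_mono) auto
    moreover have "cmod (z - of_real c * w) \<le> (q + r * (1 - q)) * cmod (z - of_real c * w)"
      using pert[OF that(1-5)] that(6) by (simp add: norm_minus_commute)
    ultimately show False by simp
  qed
  have mb1: "monomial_bound (max (cmod z) (cmod w)) 1 z w" for z w
    unfolding monomial_bound_def using monomial_term_diff_le[of z "max (cmod z) (cmod w)" w] by simp
  have inj: "inj_on F unit_disc"
  proof (rule inj_onI)
    fix z w assume "z \<in> unit_disc" "w \<in> unit_disc" "F z = F w"
    then show "z = w" using eq[OF _ _ _ _ mb1, of z w] by (simp add: le_max_iff_disj)
  qed
  have F0: "F 0 = 0"
  proof -
    \<comment> \<open>With z = w = 0 and c = 2 the estimate reads |F 0 - 2 F 0| \<le> 0; any c other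
      than 1 would serve.\<close>
    have "monomial_bound 0 2 0 0"
      by (auto simp: monomial_bound_def monomial_term_def)
    from pert[OF _ _ _ _ this] show ?thesis by simp
  qed
  have cont: "continuous_on unit_disc F"
  proof -
    \<comment> \<open>The identity contributes 1 to the Lipschitz constant, the deviation at most
      1.\<close>
    have "dist (F z) (F w) \<le> 2 * dist z w" if zw: "z \<in> unit_disc" "w \<in> unit_disc" for z w
    proof -
      let ?r = "max (cmod z) (cmod w)"
      have "cmod (F z - F w - (z - w)) \<le> (q + ?r * (1 - q)) * cmod (z - w)"
        using pert[OF _ _ _ _ mb1, of z w] zw by (simp add: le_max_iff_disj)
      also have "\<dots> \<le> 1 * cmod (z - w)"
        using lt1[of ?r] zw by (intro mult_right_mono) auto
      finally show ?thesis
        using norm_triangle_ineq[of "F z - F w - (z - w)" "z - w"] by (simp add: dist_norm)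
    qed
    then have "2-lipschitz_on unit_disc F" by (intro lipschitz_onI) auto
    then show ?thesis by (rule lipschitz_on_continuous_on)
  qed
  have "starlike_curve (F \<circ> circlepath 0 r)" if r: "0 < r" "r < 1" for r
  proof (rule starlike_curve_if_rays_cross_once)
    have img: "path_image (F \<circ> circlepath 0 r) = F ` sphere 0 r"
      using r by (simp add: path_image_compose)
    have sd: "sphere 0 r \<subseteq> unit_disc" using r by auto
    show "simple_path (F \<circ> circlepath 0 r)"
      using r sd by (intro simple_path_continuous_image continuous_on_subset[OF cont] inj_on_subset[OF inj])
        (auto simp: simple_path_circlepath)
    show "pathfinish (F \<circ> circlepath 0 r) = pathstart (F \<circ> circlepath 0 r)"
      by (simp add: pathfinish_compose pathstart_compose)
    show "0 \<notin> path_image (F \<circ> circlepath 0 r)"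
    proof
      assume "0 \<in> path_image (F \<circ> circlepath 0 r)"
      then obtain z where "cmod z = r" "F z = F 0" using F0 by (auto simp: img)
      then show False using inj_onD[OF inj, of z 0] r by auto
    qed
    show "c = 1" if x: "x \<in> path_image (F \<circ> circlepath 0 r)" and c: "0 < c"
      and cx: "of_real c * x \<in> path_image (F \<circ> circlepath 0 r)" for x c
    proof -
      obtain w where w: "cmod w = r" "x = F w" using x by (auto simp: img)
      obtain z where z: "cmod z = r" "F z = of_real c * F w" using cx w by (auto simp: img)
      have "monomial_bound r c z w"
        unfolding monomial_bound_def using monomial_term_diff_scaled_le w z r c by auto
      then have "z = of_real c * w" using eq[of z w r c] w z r by simp
      \<comment> \<open>Equal moduli turn z = c w into c = 1.\<close>
      then have "r = c * r" using w z c by (metis abs_of_pos norm_mult norm_of_real)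
      then show "c = 1" using r by simp
    qed
  qed
  then show ?thesis using inj F0 by (auto simp: starlike_mapping_def)
qed

end
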